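(* Let $N\geqslant1$, $k\geqslant0$ and $n_1,\dots,n_N\geqslant1$ be integers with $2^k n_1\cdots n_N\geqslant2$, and let $$S:=\left(\bigotimes_{j=1}^N F_{n_j}\right)\otimes H_{2^k}.$$ Then $S$ is ideal and extremal.
   Context: $F_n$ is the $n\times n$ matrix with $(i,j)$-entry $\omega_n^{(i-1)(j-1)}$, where $\omega_n=\cos(2\pi/n)-\mathsf{i}\sin(2\pi/n)$. $A\otimes B=[a_{ij}B]$ is the Kronecker product, and $\bigotimes_{j=1}^NA_j$ is the iterated Kronecker product (left-associated). $H_{2^k}$ is the Walsh matrix of order $2^k$, i.e. the $k$-fold Kronecker power of $\begin{bmatrix}1&1\\1&-1\end{bmatrix}$, with $H_1=[1]$. A matrix $A\geqslant 0$ (nonnegative) has real nonnegative entries. For $d\geqslant 2$, a $d\times d$ matrix is reducible if it is permutation-similar to a block upper triangular matrix with two nonempty square diagonal blocks, and irreducible otherwise. An invertible complex $d\times d$ matrix $S$ is a Perron similarity if $SDS^{-1}$ is irreducible and nonnegative for some diagonal matrix $D$. For $x\in\mathbb{C}^d$, $D_x$ is the diagonal matrix with diagonal $x$, $M_x:=SD_xS^{-1}$, and $e$ is the all-ones vector. Put $\mathcal{C}(S):=\{x\in\mathbb{C}^d\mid M_x\geqslant0\}$ and $\mathcal{P}(S):=\{x\in\mathcal{C}(S)\mid M_xe=e\}$. The row cone $\mathcal{C}_r(S)$ is the set of all linear combinations with nonnegative real coefficients of the rows of $S$ (viewed as column vectors). A Perron similarity $S$ is ideal if $\mathcal{C}(S)=\mathcal{C}_r(S)$.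 A stochastic matrix is a nonnegative matrix all of whose row sums equal $1$. Let $\mathbb{SL}_1^d$ be the set of $x\in\mathbb{C}^d$ with $x_1=1$ such that the multiset $\{x_1,\dots,x_d\}$ is the spectrum of some $d\times d$ stochastic matrix, and let $\pi_1:\mathbb{C}^d\to\mathbb{C}^{d-1}$ delete the first coordinate. A point $x\in\mathbb{SL}_1^d$ is extremal if $\alpha\,\pi_1(x)\notin\pi_1(\mathbb{SL}_1^d)$ for all $\alpha>1$. A Perron similarity $S$ whose first column is $e$ is extremal if $\mathcal{P}(S)$ contains an extremal point of $\mathbb{SL}_1^d$ other than $e$. *)

theory Defs
  imports
    Complex_Main
    "HOL-Library.Nonpos_Ints"
    "Jordan_Normal_Form.Char_Poly"
    "Jordan_Normal_Form.Gauss_Jordan_Elimination"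
begin

text \<open>All indices start at 0, as is usual for the types \<^typ>\<open>'a mat\<close> and \<^typ>\<open>'a vec\<close>: the
  \<open>(i, j)\<close> entry of the mathematics is the entry \<open>(i - 1, j - 1)\<close> here.\<close>


section \<open>Fourier and Walsh matrices, Kronecker products\<close>

definition dft_root :: "nat \<Rightarrow> complex" where
  "dft_root n = Complex (cos (2 * pi / real n)) (- sin (2 * pi / real n))"

definition dft_mat :: "nat \<Rightarrow> complex mat" where
  "dft_mat n = mat n n (\<lambda>(i, j). dft_root n ^ (i * j))"

definition kronecker :: "'a :: times mat \<Rightarrow> 'a mat \<Rightarrow> 'a mat" where
  "kronecker A B = mat (dim_row A * dim_row B) (dim_col A * dim_col B)
     (\<lambda>(i, j). A $$ (i div dim_row B, j div dim_col B) * B $$ (i mod dim_row B, j mod dim_col B))"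

text \<open>The left-associated product of \<open>A 1, \<dots>, A N\<close>; the empty product is the \<open>1 \<times> 1\<close> identity,
  which is a left unit.\<close>

primrec kronecker_prod :: "(nat \<Rightarrow> 'a :: semiring_1 mat) \<Rightarrow> nat \<Rightarrow> 'a mat" where
  "kronecker_prod A 0 = 1\<^sub>m 1"
| "kronecker_prod A (Suc N) = kronecker (kronecker_prod A N) (A (Suc N))"

lemma kronecker_one_left [simp]: "kronecker (1\<^sub>m 1) A = (A :: 'a :: semiring_1 mat)"
  by (rule eq_matI) (auto simp: kronecker_def)

lemma kronecker_prod_1: "kronecker_prod A (Suc 0) = A (Suc 0)"
  using kronecker_one_left by simp

text \<open>The Walsh matrix of order \<open>2 ^ k\<close>.\<close>

definition walsh_mat :: "nat \<Rightarrow> complex mat" where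
  "walsh_mat k = kronecker_prod (\<lambda>_. mat_of_rows_list 2 [[1, 1], [1, - 1]]) k"


section \<open>Nonnegative, irreducible and stochastic matrices\<close>

definition nonneg_mat :: "complex mat \<Rightarrow> bool" where
  "nonneg_mat A \<longleftrightarrow> (\<forall>i < dim_row A. \<forall>j < dim_col A. A $$ (i, j) \<in> \<real>\<^sub>\<ge>\<^sub>0)"

definition perm_mat :: "nat \<Rightarrow> (nat \<Rightarrow> nat) \<Rightarrow> complex mat" where
  "perm_mat d p = mat d d (\<lambda>(i, j). if j = p i then 1 else 0)"

definition reducible_mat :: "complex mat \<Rightarrow> bool" where
  "reducible_mat A \<longleftrightarrow>
     (\<exists>p r s B C E. r > 0 \<and> s > 0 \<and> A \<in> carrier_mat (r + s) (r + s) \<and> p permutes {..<r + s} \<and>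
        B \<in> carrier_mat r r \<and> C \<in> carrier_mat r s \<and> E \<in> carrier_mat s s \<and>
        perm_mat (r + s) p * A * transpose_mat (perm_mat (r + s) p) =
          four_block_mat B C (0\<^sub>m s r) E)"

definition irreducible_mat :: "complex mat \<Rightarrow> bool" where
  "irreducible_mat A \<longleftrightarrow> square_mat A \<and> dim_row A \<ge> 2 \<and> \<not> reducible_mat A"

definition ones_vec :: "nat \<Rightarrow> complex vec" where
  "ones_vec d = vec d (\<lambda>_. 1)"

definition stochastic_mat :: "complex mat \<Rightarrow> bool" where
  "stochastic_mat A \<longleftrightarrow> square_mat A \<and> nonneg_mat A \<and>
     (\<forall>i < dim_row A. (\<Sum>j < dim_col A. A $$ (i, j)) = 1)"


section \<open>Perron similarities\<close>

definition mat_inv :: "complex mat \<Rightarrow> complex mat" where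
  "mat_inv S = the (mat_inverse S)"

lemma mat_inv:
  assumes "invertible_mat S" and "S \<in> carrier_mat d d"
  shows "S * mat_inv S = 1\<^sub>m d" "mat_inv S * S = 1\<^sub>m d" "mat_inv S \<in> carrier_mat d d"
proof -
  from assms(1) obtain T where "S * T = 1\<^sub>m (dim_row S)" "T * S = 1\<^sub>m (dim_row T)"
    by (auto simp: invertible_mat_def inverts_mat_def)
  moreover from this have "T \<in> carrier_mat d d"
    using assms(2) by (metis carrier_matD carrier_matI index_mult_mat(2,3) index_one_mat(2,3))
  ultimately have "S \<in> Units (ring_mat TYPE(complex) d ())"
    using assms(2) by (auto simp: Units_def ring_mat_def)
  then obtain B where "mat_inverse S = Some B"
    using mat_inverse(1)[OF assms(2), where b = "()"] by (cases "mat_inverse S") auto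
  with mat_inverse(2)[OF assms(2) this]
  show "S * mat_inv S = 1\<^sub>m d" "mat_inv S * S = 1\<^sub>m d" "mat_inv S \<in> carrier_mat d d"
    by (auto simp: mat_inv_def)
qed

definition perron_similarity :: "complex mat \<Rightarrow> bool" where
  "perron_similarity S \<longleftrightarrow> invertible_mat S \<and>
     (\<exists>D \<in> carrier_mat (dim_row S) (dim_row S). diagonal_mat D \<and>
        irreducible_mat (S * D * mat_inv S) \<and> nonneg_mat (S * D * mat_inv S))"

definition M_mat :: "complex mat \<Rightarrow> complex vec \<Rightarrow> complex mat" where
  "M_mat S x = S * mat_diag (dim_vec x) (\<lambda>i. x $ i) * mat_inv S"

definition spectracone :: "complex mat \<Rightarrow> complex vec set" where
  "spectracone S = {x \<in> carrier_vec (dim_row S). nonneg_mat (M_mat S x)}"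

definition spectratope :: "complex mat \<Rightarrow> complex vec set" where
  "spectratope S = {x \<in> spectracone S. M_mat S x *\<^sub>v ones_vec (dim_row S) = ones_vec (dim_row S)}"

definition row_cone :: "complex mat \<Rightarrow> complex vec set" where
  "row_cone S = {finsum_vec TYPE(complex) (dim_col S)
       (\<lambda>i. complex_of_real (c i) \<cdot>\<^sub>v row S i) {..<dim_row S} | c :: nat \<Rightarrow> real.
     \<forall>i < dim_row S. c i \<ge> 0}"

definition ideal_similarity :: "complex mat \<Rightarrow> bool" where
  "ideal_similarity S \<longleftrightarrow> perron_similarity S \<and> spectracone S = row_cone S"


section \<open>Spectra of stochastic matrices and extremality\<close>

text \<open>The spectrum of \<open>A\<close> with algebraic multiplicities is \<open>proots (char_poly A)\<close>.\<close>

definition SL1 :: "nat \<Rightarrow> complex vec set" where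
  "SL1 d = {x \<in> carrier_vec d. x $ 0 = 1 \<and>
     (\<exists>A \<in> carrier_mat d d. stochastic_mat A \<and> proots (char_poly A) = mset (list_of_vec x))}"

definition pi1 :: "'a vec \<Rightarrow> 'a vec" where
  "pi1 x = vec (dim_vec x - 1) (\<lambda>i. x $ Suc i)"

definition extremal_point :: "nat \<Rightarrow> complex vec \<Rightarrow> bool" where
  "extremal_point d x \<longleftrightarrow> x \<in> SL1 d \<and>
     (\<forall>\<alpha> :: real. \<alpha> > 1 \<longrightarrow> complex_of_real \<alpha> \<cdot>\<^sub>v pi1 x \<notin> pi1 ` SL1 d)"

definition extremal_similarity :: "complex mat \<Rightarrow> bool" where
  "extremal_similarity S \<longleftrightarrow> perron_similarity S \<and> col S 0 = ones_vec (dim_row S) \<and>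
     (\<exists>x \<in> spectratope S. extremal_point (dim_row S) x \<and> x \<noteq> ones_vec (dim_row S))"

end

theory Submission
  imports Defs
begin

text \<open>The matrix \<open>S\<close> is the character table of the finite abelian group
  \<open>\<int>/n\<^sub>1 \<times> \<dots> \<times> \<int>/n\<^sub>N \<times> (\<int>/2)\<^sup>k\<close>, and only this is used. Write \<open>d\<close> for its order. Its rows are
  orthogonal, so \<open>S\<^sup>-\<^sup>1 = S\<^sup>* / d\<close>, and closed under \<open>(x, y) \<mapsto> x \<cdot> cnj y\<close>, so the \<open>(i, j)\<close> entry of
  \<open>M\<^sub>x\<close>, namely \<open>(\<Sum>l. x\<^sub>l S\<^sub>i\<^sub>l cnj S\<^sub>j\<^sub>l) / d\<close>, is the coefficient of \<open>x\<close> with respect to the row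
  \<open>S\<^sub>j cnj S\<^sub>i\<close> in the basis of the rows of \<open>S\<close> (\<open>M_mat_entry_row_coeff\<close>). Every coefficient occurs, for
  instance along the first row of \<open>M\<^sub>x\<close>. Hence \<open>M\<^sub>x\<close> is nonnegative exactly if \<open>x\<close> is in the row cone,
  which is idealness (\<open>spectracone_eq_row_cone\<close>). The first unit vector gives for \<open>M\<^sub>x\<close> the matrix with
  all entries \<open>1 / d\<close>, which is irreducible for \<open>d \<ge> 2\<close>, so \<open>S\<close> is a Perron similarity.

  For extremality take a row \<open>x\<close> of \<open>S\<close> other than the first. By the above it lies in the spectratope,
  so \<open>M\<^sub>x\<close> is stochastic with spectrum \<open>x\<close>, and all entries of \<open>x\<close> have modulus \<open>1\<close>. Multiplying
  them by \<open>\<alpha> > 1\<close> leaves the closed unit disc, which contains all eigenvalues of stochastic matrices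
  (\<open>stochastic_eigenvalue_norm_le_1\<close>).\<close>


section \<open>Spectra of stochastic and of diagonalised matrices\<close>

text \<open>Compare the entries of \<open>A v = \<lambda> v\<close> at an index where \<open>|v\<^sub>i|\<close> is maximal: the right-hand side is
  \<open>|\<lambda>| |v\<^sub>i|\<close>, and the left-hand side is an average of entries of \<open>v\<close>.\<close>

lemma stochastic_eigenvalue_norm_le_1:
  assumes A: "A \<in> carrier_mat d d" and st: "stochastic_mat A" and ev: "eigenvalue A z"
  shows "norm z \<le> 1"
proof -
  obtain v where v: "v \<in> carrier_vec d" "v \<noteq> 0\<^sub>v d" "A *\<^sub>v v = z \<cdot>\<^sub>v v"
    using ev A by (auto simp: eigenvalue_def eigenvector_def)
  then obtain k where k: "k < d" "v $ k \<noteq> 0"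
    by (metis carrier_vecD eq_vecI index_zero_vec(1,2))
  define m where "m = Max ((\<lambda>j. norm (v $ j)) ` {..<d})"
  have m_ge: "norm (v $ j) \<le> m" if "j < d" for j
    unfolding m_def using that by (intro Max_ge) auto
  have "m \<in> (\<lambda>j. norm (v $ j)) ` {..<d}"
    unfolding m_def using k by (intro Max_in) auto
  then obtain i where i: "i < d" "m = norm (v $ i)" by auto
  have "m > 0" using m_ge[OF k(1)] k(2) by (smt (verit) zero_less_norm_iff)
  have nn: "A $$ (i, j) = of_real (norm (A $$ (i, j)))" if "j < d" for j
  proof -
    have "A $$ (i, j) \<in> \<real>\<^sub>\<ge>\<^sub>0" using st A i that by (auto simp: stochastic_mat_def nonneg_mat_def)
    then show ?thesis by (cases rule: nonneg_Reals_cases) simp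
  qed
  have "(\<Sum>j<d. complex_of_real (norm (A $$ (i, j)))) = (\<Sum>j<d. A $$ (i, j))"
    using nn by (intro sum.cong) auto
  also have "\<dots> = 1" using st A i by (auto simp: stochastic_mat_def)
  finally have row_sum: "(\<Sum>j<d. norm (A $$ (i, j))) = 1"
    by (metis of_real_eq_1_iff of_real_sum)
  have "z * v $ i = (A *\<^sub>v v) $ i" using v i by simp
  also have "\<dots> = (\<Sum>j<d. A $$ (i, j) * v $ j)"
    using A v(1) i by (auto simp: scalar_prod_def atLeast0LessThan intro!: sum.cong)
  finally have "norm z * m = norm (\<Sum>j<d. A $$ (i, j) * v $ j)"
    using i(2) by (metis norm_mult)
  also have "\<dots> \<le> (\<Sum>j<d. norm (A $$ (i, j)) * m)"
    by (intro order.trans[OF norm_sum] sum_mono) (auto simp: norm_mult intro!: mult_left_mono m_ge)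
  also have "\<dots> = m" by (simp add: row_sum flip: sum_distrib_right)
  finally show ?thesis using \<open>m > 0\<close> by simp
qed

lemma SL1_entry_norm_le_1:
  assumes "x \<in> SL1 d" and "i < d"
  shows "norm (x $ i) \<le> 1"
proof -
  obtain A where x: "x \<in> carrier_vec d" and A: "A \<in> carrier_mat d d" "stochastic_mat A"
    and roots: "proots (char_poly A) = mset (list_of_vec x)"
    using assms(1) by (auto simp: SL1_def)
  have "char_poly A \<noteq> 0" using degree_monic_char_poly[OF A(1)] by auto
  have "x $ i \<in> set (list_of_vec x)"
    using x assms(2) by (metis carrier_vecD length_list_of_vec list_of_vec_index nth_mem)
  then have "x $ i \<in># proots (char_poly A)" by (simp add: roots)
  then have "poly (char_poly A) (x $ i) = 0" using \<open>char_poly A \<noteq> 0\<close> by simp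
  then show ?thesis
    using A stochastic_eigenvalue_norm_le_1 eigenvalue_root_char_poly by blast
qed

lemma proots_linear_factors: "proots (\<Prod>a\<leftarrow>as. [:- a, 1:]) = mset (as :: 'a :: idom list)"
proof (induction as)
  case (Cons a as)
  have "proots [:- a, 1:] = {#a#}"
    by (rule multiset_eqI) (simp add: order_linear' order_linear_power)
  moreover have "(\<Prod>a\<leftarrow>as. [:- a, 1:]) \<noteq> 0" by (auto simp: prod_list_zero_iff)
  ultimately show ?case using Cons by (simp add: proots_mult del: mult_pCons_left)
qed simp

lemma proots_char_poly_M_mat:
  assumes S: "S \<in> carrier_mat d d" "invertible_mat S" and x: "x \<in> carrier_vec d"
  shows "proots (char_poly (M_mat S x)) = mset (list_of_vec x)"
proof -
  let ?D = "mat_diag d (\<lambda>i. x $ i)"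
  have "similar_mat_wit (M_mat S x) ?D S (mat_inv S)"
    using S x mat_inv[OF S(2,1)]
    by (auto simp: similar_mat_wit_def Let_def M_mat_def)
  then have "similar_mat (M_mat S x) ?D" unfolding similar_mat_def by blast
  then have "char_poly (M_mat S x) = char_poly ?D" by (rule char_poly_similar)
  also have "\<dots> = (\<Prod>a\<leftarrow>diag_mat ?D. [:- a, 1:])"
    by (rule char_poly_upper_triangular[where n = d]) (auto simp: mat_diag_def)
  also have "diag_mat ?D = list_of_vec x"
    using x by (intro nth_equalityI) (auto simp: diag_mat_def mat_diag_def list_of_vec_index)
  finally show ?thesis by (simp only: proots_linear_factors)
qed


section \<open>Irreducible matrices and row cones\<close>

lemma irreducible_mat_if_entries_nonzero:
  assumes A: "A \<in> carrier_mat d d" and "d \<ge> 2"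
    and nz: "\<And>i j. i < d \<Longrightarrow> j < d \<Longrightarrow> A $$ (i, j) \<noteq> 0"
  shows "irreducible_mat A"
proof -
  have "\<not> reducible_mat A"
  proof
    assume "reducible_mat A"
    then obtain p r s B C E where rs: "r > 0" "s > 0" and A': "A \<in> carrier_mat (r + s) (r + s)"
      and p: "p permutes {..<r + s}" and B: "B \<in> carrier_mat r r" "E \<in> carrier_mat s s"
      and eq: "perm_mat (r + s) p * A * transpose_mat (perm_mat (r + s) p) =
        four_block_mat B C (0\<^sub>m s r) E"
      unfolding reducible_mat_def by blast
    have d: "d = r + s" using A A' by auto
    have p_less: "p i < d" if "i < d" for i
      using permutes_in_image[OF p, of i] that d by simp
    let ?P = "perm_mat d p"
    have P: "?P \<in> carrier_mat d d" by (simp add: perm_mat_def)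
    have PA: "(?P * A) $$ (i, j) = A $$ (p i, j)" if "i < d" "j < d" for i j
      using that A P p_less[OF that(1)]
      by (simp add: scalar_prod_def perm_mat_def sum.delta if_distrib if_distribR cong: if_cong)
    \<comment> \<open>\<open>(r, 0)\<close> lies in the zero block, but the conjugation only permutes the nonzero entries of \<open>A\<close>\<close>
    have "(Q * transpose_mat ?P) $$ (r, 0) = (\<Sum>k<d. Q $$ (r, k) * ?P $$ (0, k))"
      if "Q \<in> carrier_mat d d" for Q
      using that P rs d by (auto simp: scalar_prod_def atLeast0LessThan intro!: sum.cong)
    from this[of "?P * A"]
    have "(?P * A * transpose_mat ?P) $$ (r, 0) = (\<Sum>k<d. (?P * A) $$ (r, k) * ?P $$ (0, k))"
      using A P by simp
    also have "\<dots> = (\<Sum>k<d. if k = p 0 then A $$ (p r, k) else 0)"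
      using rs d PA by (intro sum.cong) (auto simp: perm_mat_def)
    also have "\<dots> = A $$ (p r, p 0)" using p_less[of 0] rs d by simp
    finally have "(?P * A * transpose_mat ?P) $$ (r, 0) \<noteq> 0"
      using nz p_less rs d by simp
    moreover have "four_block_mat B C (0\<^sub>m s r) E $$ (r, 0) = 0"
      using rs B by simp
    ultimately show False using eq d by simp
  qed
  then show ?thesis using A \<open>d \<ge> 2\<close> by (simp add: irreducible_mat_def)
qed

lemma mem_row_cone_iff:
  assumes S: "S \<in> carrier_mat d d"
  shows "x \<in> row_cone S \<longleftrightarrow> x \<in> carrier_vec d \<and>
    (\<exists>c :: nat \<Rightarrow> real. (\<forall>i<d. c i \<ge> 0) \<and> (\<forall>l<d. x $ l = (\<Sum>i<d. complex_of_real (c i) * S $$ (i, l))))"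
proof -
  let ?f = "\<lambda>c :: nat \<Rightarrow> real. finsum_vec TYPE(complex) d (\<lambda>i. complex_of_real (c i) \<cdot>\<^sub>v row S i) {..<d}"
  have carrier: "?f c \<in> carrier_vec d" for c
    using S by (intro finsum_vec_closed) (auto simp: Pi_def)
  have index: "?f c $ l = (\<Sum>i<d. complex_of_real (c i) * S $$ (i, l))" if "l < d" for c l
    using S that by (subst index_finsum_vec) (auto simp: Pi_def)
  have "x = ?f c \<longleftrightarrow> x \<in> carrier_vec d \<and>
      (\<forall>l<d. x $ l = (\<Sum>i<d. complex_of_real (c i) * S $$ (i, l)))" for c
    using carrier[of c] index[of _ c] by (auto intro!: eq_vecI)
  then show ?thesis using S unfolding row_cone_def by auto
qed

section \<open>Character tables\<close>

text \<open>The group of characters is present only through the closure of the rows under \<open>x \<cdot> cnj y\<close>; that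
  it contains the trivial character, and that the characters are trivial at the neutral element, are the
  conditions on the first row and the first column.\<close>

locale character_table =
  fixes d :: nat and S :: "complex mat"
  assumes carrier: "S \<in> carrier_mat d d"
    and row_0: "\<And>l. l < d \<Longrightarrow> S $$ (0, l) = 1"
    and col_0: "\<And>i. i < d \<Longrightarrow> S $$ (i, 0) = 1"
    and rows_closed:
      "\<And>i j. i < d \<Longrightarrow> j < d \<Longrightarrow> \<exists>m<d. \<forall>l<d. S $$ (i, l) * cnj (S $$ (j, l)) = S $$ (m, l)"
    and rows_orthogonal:
      "\<And>i j. i < d \<Longrightarrow> j < d \<Longrightarrow>
        (\<Sum>l<d. S $$ (i, l) * cnj (S $$ (j, l))) = (if i = j then of_nat d else 0)"
begin

text \<open>By closure, \<open>|S\<^sub>i|\<^sup>2\<close> is a row \<open>S\<^sub>m\<close>. Its sum is \<open>d\<close>, so \<open>S\<^sub>m\<close> is not orthogonal to the all-ones row;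
  hence it is that row.\<close>

lemma norm_entry:
  assumes "i < d" and "l < d"
  shows "norm (S $$ (i, l)) = 1"
proof -
  obtain m where m: "m < d" "\<And>l. l < d \<Longrightarrow> S $$ (i, l) * cnj (S $$ (i, l)) = S $$ (m, l)"
    using rows_closed[OF assms(1,1)] by auto
  have "(\<Sum>l<d. S $$ (m, l) * cnj (S $$ (0, l))) = (\<Sum>l<d. S $$ (i, l) * cnj (S $$ (i, l)))"
    using m(2) row_0 by (intro sum.cong) auto
  also have "\<dots> = of_nat d" using rows_orthogonal[OF assms(1,1)] by simp
  finally have "m = 0"
    using rows_orthogonal[OF m(1), of 0] assms by (auto split: if_splits)
  then have "(norm (S $$ (i, l)))\<^sup>2 = 1"
    using m(2)[OF assms(2)] row_0[OF assms(2)] by (metis complex_norm_square of_real_eq_1_iff)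
  then show ?thesis using power2_eq_1_iff norm_ge_zero by (smt (verit))
qed

definition inv_table :: "complex mat" where
  "inv_table = mat d d (\<lambda>(l, j). cnj (S $$ (j, l)) / of_nat d)"

lemma inv_table_carrier: "inv_table \<in> carrier_mat d d"
  by (simp add: inv_table_def)

lemma mult_inv_table: "S * inv_table = 1\<^sub>m d"
proof (rule eq_matI)
  fix i j assume "i < dim_row (1\<^sub>m d)" "j < dim_col (1\<^sub>m d)"
  then have ij: "i < d" "j < d" by auto
  have "(S * inv_table) $$ (i, j) = (\<Sum>l<d. S $$ (i, l) * cnj (S $$ (j, l))) / of_nat d"
    using carrier ij
    by (auto simp: inv_table_def scalar_prod_def atLeast0LessThan sum_divide_distrib intro!: sum.cong)
  then show "(S * inv_table) $$ (i, j) = 1\<^sub>m d $$ (i, j)"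
    using rows_orthogonal[OF ij] ij by simp
qed (use carrier inv_table_carrier in auto)

lemma inv_table_mult: "inv_table * S = 1\<^sub>m d"
  by (rule mat_mult_left_right_inverse[OF carrier inv_table_carrier mult_inv_table])

lemma invertible: "invertible_mat S"
  using carrier inv_table_carrier mult_inv_table inv_table_mult
  by (auto simp: invertible_mat_def inverts_mat_def square_mat.simps intro!: exI[of _ inv_table])

lemma mat_inv_eq: "mat_inv S = inv_table"
proof -
  note I = mat_inv[OF invertible carrier]
  have "mat_inv S = mat_inv S * (S * inv_table)" using I(3) by (simp add: mult_inv_table)
  also have "\<dots> = mat_inv S * S * inv_table"
    using I(3) carrier inv_table_carrier by (simp add: assoc_mult_mat)
  also have "\<dots> = inv_table" using inv_table_carrier by (simp add: I(2))
  finally show ?thesis .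
qed

lemma cols_orthogonal:
  assumes "l < d" and "k < d"
  shows "(\<Sum>i<d. cnj (S $$ (i, l)) * S $$ (i, k)) = (if l = k then of_nat d else 0)"
proof -
  have "(inv_table * S) $$ (l, k) = (\<Sum>i<d. cnj (S $$ (i, l)) * S $$ (i, k)) / of_nat d"
    using carrier assms
    by (auto simp: inv_table_def scalar_prod_def atLeast0LessThan sum_divide_distrib intro!: sum.cong)
  then show ?thesis using inv_table_mult assms by (auto simp: field_simps split: if_splits)
qed

lemma M_mat_carrier: "x \<in> carrier_vec d \<Longrightarrow> M_mat S x \<in> carrier_mat d d"
  using carrier inv_table_carrier by (auto simp: M_mat_def mat_inv_eq)

lemma M_mat_entry:
  assumes "x \<in> carrier_vec d" and "i < d" and "j < d"
  shows "M_mat S x $$ (i, j) = (\<Sum>l<d. x $ l * (S $$ (i, l) * cnj (S $$ (j, l)))) / of_nat d"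
  using assms carrier
  by (auto simp: M_mat_def mat_inv_eq mat_diag_mult_right[OF carrier] inv_table_def scalar_prod_def
      atLeast0LessThan sum_divide_distrib mult_ac intro!: sum.cong)

definition row_coeff :: "complex vec \<Rightarrow> nat \<Rightarrow> complex" where
  "row_coeff x m = (\<Sum>l<d. x $ l * cnj (S $$ (m, l))) / of_nat d"

lemma row_expansion:
  assumes "l < d"
  shows "x $ l = (\<Sum>m<d. row_coeff x m * S $$ (m, l))"
proof -
  have "(\<Sum>m<d. row_coeff x m * S $$ (m, l)) =
      (\<Sum>m<d. \<Sum>k<d. x $ k * (cnj (S $$ (m, k)) * S $$ (m, l)) / of_nat d)"
    by (simp add: row_coeff_def sum_distrib_left sum_distrib_right sum_divide_distrib mult_ac)
  also have "\<dots> = (\<Sum>k<d. x $ k * (\<Sum>m<d. cnj (S $$ (m, k)) * S $$ (m, l)) / of_nat d)"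
    by (subst sum.swap) (simp add: sum_distrib_left sum_divide_distrib)
  also have "\<dots> = (\<Sum>k<d. if k = l then x $ k else 0)"
    using assms cols_orthogonal[OF _ assms] by (intro sum.cong) auto
  also have "\<dots> = x $ l" using assms by simp
  finally show ?thesis ..
qed

lemma row_coeff_unique:
  assumes "\<And>l. l < d \<Longrightarrow> x $ l = (\<Sum>i<d. c i * S $$ (i, l))" and m: "m < d"
  shows "row_coeff x m = c m"
proof -
  have "(\<Sum>l<d. x $ l * cnj (S $$ (m, l))) =
      (\<Sum>l<d. \<Sum>i<d. c i * (S $$ (i, l) * cnj (S $$ (m, l))))"
    by (simp add: assms(1) sum_distrib_left sum_distrib_right mult_ac)
  also have "\<dots> = (\<Sum>i<d. c i * (\<Sum>l<d. S $$ (i, l) * cnj (S $$ (m, l))))"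
    by (subst sum.swap) (simp add: sum_distrib_left)
  also have "\<dots> = (\<Sum>i<d. if i = m then c i * of_nat d else 0)"
    using rows_orthogonal[OF _ m] by (intro sum.cong) auto
  also have "\<dots> = c m * of_nat d" using m by simp
  finally show ?thesis using m by (simp add: row_coeff_def)
qed

text \<open>Here the group structure enters: \<open>S\<^sub>i cnj S\<^sub>j\<close> is the conjugate of the row \<open>S\<^sub>j cnj S\<^sub>i\<close>.\<close>

lemma M_mat_entry_row_coeff:
  assumes x: "x \<in> carrier_vec d" and ij: "i < d" "j < d"
  shows "\<exists>m<d. M_mat S x $$ (i, j) = row_coeff x m"
proof -
  obtain m where m: "m < d" "\<And>l. l < d \<Longrightarrow> S $$ (j, l) * cnj (S $$ (i, l)) = S $$ (m, l)"
    using rows_closed[OF ij(2,1)] by auto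
  have "S $$ (i, l) * cnj (S $$ (j, l)) = cnj (S $$ (m, l))" if "l < d" for l
    by (simp flip: m(2)[OF that])
  then have "M_mat S x $$ (i, j) = row_coeff x m"
    using M_mat_entry[OF x ij] by (simp add: row_coeff_def)
  then show ?thesis using m(1) by blast
qed

lemma M_mat_first_row:
  assumes "x \<in> carrier_vec d" and "j < d"
  shows "M_mat S x $$ (0, j) = row_coeff x j"
  using assms M_mat_entry[OF assms(1), of 0 j] row_0 by (simp add: row_coeff_def)

lemma mem_spectracone_iff:
  "x \<in> spectracone S \<longleftrightarrow> x \<in> carrier_vec d \<and> (\<forall>m<d. row_coeff x m \<in> \<real>\<^sub>\<ge>\<^sub>0)"
proof (cases "x \<in> carrier_vec d")
  case True
  have "nonneg_mat (M_mat S x) \<longleftrightarrow> (\<forall>i<d. \<forall>j<d. M_mat S x $$ (i, j) \<in> \<real>\<^sub>\<ge>\<^sub>0)"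
    using M_mat_carrier[OF True] by (auto simp: nonneg_mat_def)
  also have "\<dots> \<longleftrightarrow> (\<forall>m<d. row_coeff x m \<in> \<real>\<^sub>\<ge>\<^sub>0)"
  proof (intro iffI allI impI)
    fix m assume "\<forall>i<d. \<forall>j<d. M_mat S x $$ (i, j) \<in> \<real>\<^sub>\<ge>\<^sub>0" "m < d"
    then show "row_coeff x m \<in> \<real>\<^sub>\<ge>\<^sub>0"
      using M_mat_first_row[OF True] by (metis gr_implies_not0 neq0_conv)
  next
    fix i j assume "\<forall>m<d. row_coeff x m \<in> \<real>\<^sub>\<ge>\<^sub>0" "i < d" "j < d"
    then show "M_mat S x $$ (i, j) \<in> \<real>\<^sub>\<ge>\<^sub>0"
      using M_mat_entry_row_coeff[OF True] by metis
  qed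
  finally show ?thesis using True carrier by (simp add: spectracone_def)
qed (use carrier in \<open>auto simp: spectracone_def\<close>)

theorem spectracone_eq_row_cone: "spectracone S = row_cone S"
proof (intro subset_antisym subsetI)
  fix x assume "x \<in> spectracone S"
  then have x: "x \<in> carrier_vec d" and nn: "\<And>m. m < d \<Longrightarrow> row_coeff x m \<in> \<real>\<^sub>\<ge>\<^sub>0"
    by (auto simp: mem_spectracone_iff)
  have re: "row_coeff x m = of_real (Re (row_coeff x m))" "Re (row_coeff x m) \<ge> 0" if "m < d" for m
    using nn[OF that] by (auto elim!: nonneg_Reals_cases)
  have "x $ l = (\<Sum>m<d. complex_of_real (Re (row_coeff x m)) * S $$ (m, l))" if "l < d" for l
  proof -
    have "x $ l = (\<Sum>m<d. row_coeff x m * S $$ (m, l))" by (rule row_expansion[OF that])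
    also have "\<dots> = (\<Sum>m<d. complex_of_real (Re (row_coeff x m)) * S $$ (m, l))"
      using re(1) by (intro sum.cong) auto
    finally show ?thesis .
  qed
  then show "x \<in> row_cone S"
    unfolding mem_row_cone_iff[OF carrier] using x re(2)
    by (intro conjI exI[of _ "\<lambda>m. Re (row_coeff x m)"]) auto
next
  fix x assume "x \<in> row_cone S"
  then obtain c :: "nat \<Rightarrow> real" where x: "x \<in> carrier_vec d" and c: "\<And>i. i < d \<Longrightarrow> c i \<ge> 0"
    "\<And>l. l < d \<Longrightarrow> x $ l = (\<Sum>i<d. complex_of_real (c i) * S $$ (i, l))"
    unfolding mem_row_cone_iff[OF carrier] by (elim conjE exE) (rule that, auto)
  have "row_coeff x m = complex_of_real (c m)" if "m < d" for m
    by (rule row_coeff_unique[OF c(2) that])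
  then show "x \<in> spectracone S" using x c(1) by (auto simp: mem_spectracone_iff)
qed

lemma perron_similarity:
  assumes d: "d \<ge> 2"
  shows "perron_similarity S"
proof -
  let ?x = "unit_vec d 0 :: complex vec"
  let ?D = "mat_diag d (\<lambda>i. ?x $ i)"
  have M: "M_mat S ?x = S * ?D * mat_inv S" by (simp add: M_mat_def)
  have entry: "M_mat S ?x $$ (i, j) = of_real (1 / real d)" if ij: "i < d" "j < d" for i j
  proof -
    have "(\<Sum>l<d. ?x $ l * (S $$ (i, l) * cnj (S $$ (j, l)))) = (\<Sum>l<d. if l = 0 then 1 else 0)"
      using col_0[OF ij(1)] col_0[OF ij(2)] by (intro sum.cong) auto
    then show ?thesis using M_mat_entry[OF _ ij, of ?x] d by simp
  qed
  have "irreducible_mat (M_mat S ?x)"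
    using d entry by (intro irreducible_mat_if_entries_nonzero[OF M_mat_carrier]) auto
  moreover have "nonneg_mat (M_mat S ?x)"
    using M_mat_carrier[of ?x] entry by (auto simp: nonneg_mat_def simp del: of_real_divide)
  moreover have "diagonal_mat ?D" by (auto simp: diagonal_mat_def mat_diag_def)
  ultimately show ?thesis
    unfolding perron_similarity_def M using carrier invertible by (auto intro!: bexI[of _ ?D])
qed

text \<open>The all-ones vector is the first column of \<open>S\<close>, hence an eigenvector of \<open>M\<^sub>x\<close> for the first entry of
  \<open>x\<close>.\<close>

lemma M_mat_row_sum:
  assumes x: "x \<in> carrier_vec d" and i: "i < d"
  shows "(\<Sum>j<d. M_mat S x $$ (i, j)) = x $ 0"
proof -
  have "(\<Sum>j<d. M_mat S x $$ (i, j)) =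
      (\<Sum>j<d. \<Sum>l<d. x $ l * S $$ (i, l) * (cnj (S $$ (j, l)) * S $$ (j, 0)) / of_nat d)"
    using i by (intro sum.cong refl) (simp add: M_mat_entry[OF x] col_0 sum_divide_distrib mult_ac)
  also have "\<dots> = (\<Sum>l<d. x $ l * S $$ (i, l) * (\<Sum>j<d. cnj (S $$ (j, l)) * S $$ (j, 0)) / of_nat d)"
    by (subst sum.swap) (simp add: sum_distrib_left sum_divide_distrib)
  also have "\<dots> = (\<Sum>l<d. if l = 0 then x $ l else 0)"
    using cols_orthogonal[of _ 0] i col_0[OF i] by (intro sum.cong) auto
  also have "\<dots> = x $ 0" using i by (simp add: sum.delta)
  finally show ?thesis .
qed

lemma row_mem_spectracone:
  assumes "m < d"
  shows "row S m \<in> spectracone S"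
proof -
  have "row_coeff (row S m) k = (if k = m then 1 else 0)" if "k < d" for k
    using assms carrier that by (intro row_coeff_unique) 
      (auto simp: if_distrib[of "\<lambda>c. c * z" for z] cong: if_cong)
  then show ?thesis using assms carrier by (auto simp: mem_spectracone_iff)
qed

lemma extremal_similarity:
  assumes d: "d \<ge> 2"
  shows "extremal_similarity S"
proof -
  let ?x = "row S 1"
  have x: "?x \<in> carrier_vec d" using carrier by auto
  have x_0: "?x $ 0 = 1" using carrier d col_0 by simp
  have M: "M_mat S ?x \<in> carrier_mat d d" by (rule M_mat_carrier[OF x])
  have cone: "?x \<in> spectracone S" using d by (intro row_mem_spectracone) auto
  then have nn: "nonneg_mat (M_mat S ?x)" by (simp add: spectracone_def)
  have "M_mat S ?x *\<^sub>v ones_vec d = ones_vec d"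
    using M M_mat_row_sum[OF x] x_0
    by (intro eq_vecI) (auto simp: ones_vec_def scalar_prod_def atLeast0LessThan)
  then have tope: "?x \<in> spectratope S"
    using cone carrier by (simp add: spectratope_def)
  have "stochastic_mat (M_mat S ?x)"
    using M nn M_mat_row_sum[OF x] x_0 by (auto simp: stochastic_mat_def)
  then have SL: "?x \<in> SL1 d"
    using x x_0 M proots_char_poly_M_mat[OF carrier invertible x] by (auto simp: SL1_def)
  have "complex_of_real \<alpha> \<cdot>\<^sub>v pi1 ?x \<notin> pi1 ` SL1 d" if "\<alpha> > 1" for \<alpha> :: real
  proof
    assume "complex_of_real \<alpha> \<cdot>\<^sub>v pi1 ?x \<in> pi1 ` SL1 d"
    then obtain y where y: "y \<in> SL1 d" "complex_of_real \<alpha> \<cdot>\<^sub>v pi1 ?x = pi1 y" by auto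
    have "y \<in> carrier_vec d" using y(1) by (simp add: SL1_def)
    then have "complex_of_real \<alpha> * S $$ (1, 1) = y $ 1"
      using arg_cong[OF y(2), of "\<lambda>v. v $ 0"] d carrier by (simp add: pi1_def)
    then have "norm (y $ 1) = norm (complex_of_real \<alpha> * S $$ (1, 1))" by simp
    also have "\<dots> = \<alpha>" using norm_entry[of 1 1] d that by (simp add: norm_mult)
    finally show False using SL1_entry_norm_le_1[OF y(1), of 1] d that by simp
  qed
  with SL have "extremal_point d ?x" by (simp add: extremal_point_def)
  moreover have "?x \<noteq> ones_vec d"
  proof
    assume "?x = ones_vec d"
    then have "S $$ (1, l) = 1" if "l < d" for l
      using that d carrier by (metis index_row(1) carrier_matD index_vec ones_vec_def Suc_1 Suc_le_eq)
    \<comment> \<open>the row would equal the first one, to which it is orthogonal\<close>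
    then have "(\<Sum>l<d. S $$ (1, l) * cnj (S $$ (0, l))) = of_nat d" using row_0 by simp
    then show False using rows_orthogonal[of 1 0] d by simp
  qed
  moreover have "col S 0 = ones_vec d"
    using carrier col_0 d by (intro eq_vecI) (auto simp: ones_vec_def)
  ultimately show ?thesis
    using perron_similarity[OF d] tope carrier by (auto simp: extremal_similarity_def)
qed

end


section \<open>Kronecker products of Fourier matrices\<close>

lemma sum_div_mod:
  fixes f :: "nat \<Rightarrow> nat \<Rightarrow> 'a :: comm_monoid_add"
  shows "(\<Sum>l<a * b. f (l div b) (l mod b)) = (\<Sum>i<a. \<Sum>j<b. f i j)"
proof -
  have "(\<Sum>l<a * b. f (l div b) (l mod b)) = (\<Sum>i<a. \<Sum>l = i * b..<i * b + b. f (l div b) (l mod b))"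
    by (rule sum.nat_group[symmetric])
  also have "\<dots> = (\<Sum>i<a. \<Sum>j<b. f i j)"
  proof (rule sum.cong[OF refl])
    fix i
    show "(\<Sum>l = i * b..<i * b + b. f (l div b) (l mod b)) = (\<Sum>j<b. f i j)"
      by (rule sum.reindex_bij_witness[of _ "\<lambda>j. i * b + j" "\<lambda>l. l - i * b"])
        (auto simp: div_mult_self3 le_iff_add)
  qed
  finally show ?thesis .
qed

text \<open>The product of character tables belongs to the product of the groups, whose elements are indexed by
  quotient and remainder.\<close>

lemma character_table_kronecker:
  assumes "character_table a A" and "character_table b B"
  shows "character_table (a * b) (kronecker A B)"
proof -
  interpret A: character_table a A by (rule assms)
  interpret B: character_table b B by (rule assms)
  have dims: "dim_row A = a" "dim_col A = a" "dim_row B = b" "dim_col B = b"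
    using A.carrier B.carrier by auto
  have entry: "kronecker A B $$ (i, j) = A $$ (i div b, j div b) * B $$ (i mod b, j mod b)"
    if "i < a * b" "j < a * b" for i j
    using that by (simp add: kronecker_def dims)
  have less: "i div b < a" "i mod b < b" if "i < a * b" for i
    using that by (auto simp: less_mult_imp_div_less intro!: mod_less_divisor gr0I)
  show ?thesis
  proof
    show "kronecker A B \<in> carrier_mat (a * b) (a * b)" by (simp add: kronecker_def dims)
  next
    fix l assume "l < a * b"
    then show "kronecker A B $$ (0, l) = 1" "kronecker A B $$ (l, 0) = 1"
      using entry[of 0 l] entry[of l 0] less[of l] A.row_0 B.row_0 A.col_0 B.col_0 by auto
  next
    fix i j assume i: "i < a * b" and j: "j < a * b"
    obtain m where m: "m < a"
      "\<And>l. l < a \<Longrightarrow> A $$ (i div b, l) * cnj (A $$ (j div b, l)) = A $$ (m, l)"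
      using A.rows_closed less i j by meson
    obtain k where k: "k < b"
      "\<And>l. l < b \<Longrightarrow> B $$ (i mod b, l) * cnj (B $$ (j mod b, l)) = B $$ (k, l)"
      using B.rows_closed less i j by meson
    have mk: "m * b + k < a * b"
      using m(1) k(1) by (metis add_less_mono1 add.commute less_le_trans mult_Suc mult_le_mono1 Suc_leI)
    have prod: "kronecker A B $$ (i, l) * cnj (kronecker A B $$ (j, l)) =
        (A $$ (i div b, l div b) * cnj (A $$ (j div b, l div b))) *
        (B $$ (i mod b, l mod b) * cnj (B $$ (j mod b, l mod b)))" if "l < a * b" for l
      using that i j by (simp add: entry)
    have "kronecker A B $$ (i, l) * cnj (kronecker A B $$ (j, l)) = kronecker A B $$ (m * b + k, l)"
      if "l < a * b" for l
      using prod[OF that] m(2) k less[OF that] entry[OF mk that] by simp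
    then show "\<exists>m<a * b. \<forall>l<a * b.
        kronecker A B $$ (i, l) * cnj (kronecker A B $$ (j, l)) = kronecker A B $$ (m, l)"
      using mk by blast
    have "(\<Sum>l<a * b. kronecker A B $$ (i, l) * cnj (kronecker A B $$ (j, l))) =
        (\<Sum>l<a * b. (A $$ (i div b, l div b) * cnj (A $$ (j div b, l div b))) *
          (B $$ (i mod b, l mod b) * cnj (B $$ (j mod b, l mod b))))"
      using prod by (intro sum.cong) auto
    also have "\<dots> = (\<Sum>l<a. A $$ (i div b, l) * cnj (A $$ (j div b, l))) *
        (\<Sum>l<b. B $$ (i mod b, l) * cnj (B $$ (j mod b, l)))"
      by (subst sum_div_mod) (simp add: sum_product)
    also have "\<dots> = (if i div b = j div b \<and> i mod b = j mod b then of_nat (a * b) else 0)"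
      using A.rows_orthogonal B.rows_orthogonal less i j by simp
    also have "i div b = j div b \<and> i mod b = j mod b \<longleftrightarrow> i = j"
      by (metis div_mult_mod_eq)
    finally show "(\<Sum>l<a * b. kronecker A B $$ (i, l) * cnj (kronecker A B $$ (j, l))) =
        (if i = j then of_nat (a * b) else 0)" .
  qed
qed

lemma character_table_one: "character_table 1 (1\<^sub>m 1)"
  by unfold_locales auto

lemma character_table_kronecker_prod:
  assumes "\<And>j. j \<in> {1..N} \<Longrightarrow> character_table (a j) (A j)"
  shows "character_table (\<Prod>j = 1..N. a j) (kronecker_prod A N)"
  using assms
proof (induction N)
  case 0
  show ?case using character_table_one by simp
next
  case (Suc N)
  then have "character_table ((\<Prod>j = 1..N. a j) * a (Suc N)) (kronecker_prod A (Suc N))"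
    by (auto intro!: character_table_kronecker)
  then show ?case by (simp add: mult.commute)
qed

lemma dft_root_eq_cis: "dft_root n = cnj (cis (2 * pi / real n))"
  by (simp add: dft_root_def complex_eq_iff)

lemma dft_root_power_self:
  assumes "n > 0"
  shows "dft_root n ^ n = 1"
  using assms by (simp add: dft_root_eq_cis DeMoivre flip: complex_cnj_power)

lemma dft_root_power_eq_1D:
  assumes "dft_root n ^ m = 1" and "m < n"
  shows "m = 0"
proof -
  have "cnj (dft_root n ^ m) = 1" using assms(1) by simp
  then have "cis (2 * pi * real m / real n) = cis (2 * pi * real 0 / real n)"
    by (simp add: dft_root_eq_cis DeMoivre mult_ac)
  then show ?thesis
    using inj_onD[OF bij_betw_imp_inj_on[OF bij_betw_roots_unity[of n]], of m 0] assms(2) by simp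
qed

text \<open>The group is \<open>\<int>/n\<close>: the row \<open>S\<^sub>i cnj S\<^sub>j\<close> has index \<open>i - j\<close> modulo \<open>n\<close>, which \<open>i + (n - j)\<close>
  represents without truncated subtraction. Orthogonality is the geometric sum over the powers of a
  root of unity that is not \<open>1\<close>.\<close>

lemma character_table_dft_mat:
  assumes n: "n > 0"
  shows "character_table n (dft_mat n)"
proof -
  let ?w = "dft_root n"
  have w_mod: "?w ^ (m mod n) = ?w ^ m" for m
  proof -
    have "?w ^ m = ?w ^ (n * (m div n) + m mod n)" by simp
    also have "\<dots> = ?w ^ (m mod n)" by (simp only: power_add power_mult dft_root_power_self[OF n]) simp
    finally show ?thesis ..
  qed
  have entry: "dft_mat n $$ (i, l) = (?w ^ i) ^ l" if "i < n" "l < n" for i l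
    using that by (simp add: dft_mat_def power_mult)
  have w_cnj: "?w * cnj ?w = 1"
    by (simp add: dft_root_eq_cis cis_cnj cis_mult)
  have w_diff: "?w ^ i * cnj (?w ^ j) = ?w ^ (i + (n - j))" if "j < n" for i j
  proof -
    have "?w ^ j * ?w ^ (n - j) = 1"
      using that dft_root_power_self[OF n] by (simp flip: power_add)
    moreover have "?w ^ j * cnj (?w ^ j) = 1"
      using w_cnj by (metis complex_cnj_power power_mult_distrib power_one)
    ultimately have "cnj (?w ^ j) = ?w ^ (n - j)"
      by (metis mult.commute mult.left_commute mult.right_neutral)
    then show ?thesis by (simp add: power_add)
  qed
  have prod: "dft_mat n $$ (i, l) * cnj (dft_mat n $$ (j, l)) = (?w ^ (i + (n - j))) ^ l"
    if "i < n" "j < n" "l < n" for i j l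
  proof -
    have "dft_mat n $$ (i, l) * cnj (dft_mat n $$ (j, l)) = (?w ^ i * cnj (?w ^ j)) ^ l"
      using that by (simp add: entry power_mult_distrib)
    then show ?thesis using that(2) by (simp only: w_diff)
  qed
  show ?thesis
  proof
    show "dft_mat n \<in> carrier_mat n n" by (simp add: dft_mat_def)
  next
    fix l assume "l < n"
    then show "dft_mat n $$ (0, l) = 1" "dft_mat n $$ (l, 0) = 1" using entry n by auto
  next
    fix i j assume ij: "i < n" "j < n"
    let ?m = "(i + (n - j)) mod n"
    have "dft_mat n $$ (i, l) * cnj (dft_mat n $$ (j, l)) = dft_mat n $$ (?m, l)" if "l < n" for l
      using prod[OF ij that] entry[of ?m l] that n by (simp only: w_mod mod_less_divisor)
    then show "\<exists>m<n. \<forall>l<n. dft_mat n $$ (i, l) * cnj (dft_mat n $$ (j, l)) = dft_mat n $$ (m, l)"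
      using n by (intro exI[of _ ?m]) auto
    let ?z = "?w ^ (i + (n - j))"
    have sum: "(\<Sum>l<n. dft_mat n $$ (i, l) * cnj (dft_mat n $$ (j, l))) = (\<Sum>l<n. ?z ^ l)"
      using prod[OF ij] by (intro sum.cong) auto
    show "(\<Sum>l<n. dft_mat n $$ (i, l) * cnj (dft_mat n $$ (j, l))) = (if i = j then of_nat n else 0)"
    proof (cases "i = j")
      case True
      then have "?z = 1" using ij dft_root_power_self[OF n] by simp
      then show ?thesis using True sum by simp
    next
      case False
      have "?m \<noteq> 0"
      proof (cases "j < i")
        case True
        then have "i + (n - j) = (i - j) + n" using ij by simp
        then have "?m = i - j" using ij by (simp only: mod_add_self2) simp
        then show ?thesis using True by simp
      next
        \<comment> \<open>here \<open>i < j\<close>, so \<open>i + (n - j)\<close> lies strictly between \<open>0\<close> and \<open>n\<close>\<close>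
        case _: False
        then have "i + (n - j) < n" using \<open>i \<noteq> j\<close> ij by linarith
        then show ?thesis using ij by simp
      qed
      then have "?z \<noteq> 1"
        using dft_root_power_eq_1D[of n ?m] n by (auto simp: w_mod)
      moreover have "?z ^ n = 1"
        using dft_root_power_self[OF n] by (metis mult.commute power_mult power_one)
      ultimately have "(\<Sum>l<n. ?z ^ l) = 0" by (simp add: sum_gp_strict)
      then show ?thesis using False sum by simp
    qed
  qed
qed

text \<open>So Walsh matrices are themselves Kronecker powers of a Fourier matrix.\<close>

lemma dft_mat_2: "dft_mat 2 = mat_of_rows_list 2 [[1, 1], [1, - 1]]"
proof -
  have "dft_root 2 = - 1" by (simp add: dft_root_def complex_eq_iff)
  then show ?thesis
    by (intro eq_matI) (auto simp: dft_mat_def mat_of_rows_list_def numeral_2_eq_2 less_Suc_eq)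
qed

lemma character_table_walsh_mat: "character_table (2 ^ k) (walsh_mat k)"
  using character_table_kronecker_prod[of k "\<lambda>_. 2" "\<lambda>_. dft_mat 2"] character_table_dft_mat[of 2]
  by (simp add: walsh_mat_def dft_mat_2)

theorem corollary7p17:
  fixes N k :: nat and n :: "nat \<Rightarrow> nat" and S :: "complex mat"
  assumes "N \<ge> 1"
    and "\<And>j. j \<in> {1..N} \<Longrightarrow> n j \<ge> 1"
    and "2 ^ k * (\<Prod>j = 1..N. n j) \<ge> 2"
    and "S = kronecker (kronecker_prod (\<lambda>j. dft_mat (n j)) N) (walsh_mat k)"
  shows "ideal_similarity S \<and> extremal_similarity S"
proof -
  have "character_table (\<Prod>j = 1..N. n j) (kronecker_prod (\<lambda>j. dft_mat (n j)) N)"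
    by (intro character_table_kronecker_prod character_table_dft_mat)
      (use assms(2) in \<open>simp add: Suc_le_eq\<close>)
  then interpret character_table "(\<Prod>j = 1..N. n j) * 2 ^ k" S
    unfolding assms(4) by (rule character_table_kronecker[OF _ character_table_walsh_mat])
  have "(\<Prod>j = 1..N. n j) * 2 ^ k \<ge> 2" using assms(3) by (simp add: mult.commute)
  then show ?thesis
    using perron_similarity extremal_similarity spectracone_eq_row_cone
    by (simp add: ideal_similarity_def)
qed

end
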